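(* Let $f$ be a $q$-function on an open interval $\mathcal{X}\subseteq\mathbb{R}$. If $Lf=0$, then $f$ is $0$-homogeneous.
   Context: Let $\mathcal{X}\subseteq\mathbb{R}$ be an open interval (possibly unbounded). A $q$-function of order $m$ ($m\ge 0$ an integer) is an infinitely differentiable real-valued function $f(x,q_0,q_1,\ldots,q_m)$ on $\mathcal{X}\times\mathbb{R}^+\times\mathbb{R}^m$, where $x\in\mathcal{X}$, $q_0\in\mathbb{R}^+=(0,\infty)$ and $q_1,\ldots,q_m\in\mathbb{R}$. A $q$-function is a $q$-function of some finite order; a $q$-function of order $m$ is also regarded as one of any order $m'\ge m$ that does not depend on $q_{m+1},\ldots,q_{m'}$. Write $\mathbf{q}=(q_0,q_1,\ldots)$. Operators on $q$-functions (all sums are finite on any given $q$-function): $$D=\frac{\partial}{\partial x}+\sum_{j\ge0}q_{j+1}\frac{\partial}{\partial q_j},\qquad Lf=\sum_{k\ge0}(-1)^{k+1}D^k\Bigl(q_0\frac{\partial f}{\partial q_k}\Bigr).$$ A $q$-function $f$ is $0$-homogeneous if $f(x,\lambda\mathbf{q})=f(x,\mathbf{q})$ for all $\lambda>0$ and all $x,\mathbf{q}$. *)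

theory Defs
  imports "HOL-Analysis.Analysis"
begin

text \<open>A q-function takes the point \<open>x\<close> and the whole sequence \<open>q\<^sub>0, q\<^sub>1, \<dots>\<close>, represented as a
  function \<open>nat \<Rightarrow> real\<close>; a function of order \<open>m\<close> depends only on \<open>q 0, \<dots>, q m\<close>.  Hence a q-function
  of order \<open>m\<close> is literally also one of every order \<open>m' \<ge> m\<close>.  Functions are total, but
  only their values on the following domain matter.  Every derivative below is taken in a single
  real variable at a point of this domain, and so is determined by the values on the domain when
  \<open>X\<close> is open.\<close>

type_synonym qfun = "real \<Rightarrow> (nat \<Rightarrow> real) \<Rightarrow> real"

definition qdom :: "real set \<Rightarrow> (real \<times> (nat \<Rightarrow> real)) set" where
  "qdom X = X \<times> {q. 0 < q 0}"

definition partial_x :: "qfun \<Rightarrow> qfun" where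
  "partial_x f = (\<lambda>x q. deriv (\<lambda>t. f t q) x)"

definition partial_q :: "nat \<Rightarrow> qfun \<Rightarrow> qfun" where
  "partial_q j f = (\<lambda>x q. deriv (\<lambda>t. f x (q(j := t))) (q j))"

text \<open>Class \<open>C\<^sup>k\<close>: all partial derivatives up to order \<open>k\<close> exist and are continuous.  Continuity refers
  to the product topology on \<open>nat \<Rightarrow> real\<close>; for a function that depends only on \<open>q 0, \<dots>, q m\<close> this
  is ordinary joint continuity in \<open>x, q 0, \<dots>, q m\<close>.\<close>

primrec cont_diff :: "real set \<Rightarrow> nat \<Rightarrow> qfun \<Rightarrow> bool" where
  "cont_diff X 0 f \<longleftrightarrow> continuous_on (qdom X) (\<lambda>(x, q). f x q)"
| "cont_diff X (Suc k) f \<longleftrightarrow>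
     continuous_on (qdom X) (\<lambda>(x, q). f x q) \<and>
     (\<forall>(x, q) \<in> qdom X. (\<lambda>t. f t q) differentiable (at x)) \<and>
     (\<forall>j. \<forall>(x, q) \<in> qdom X. (\<lambda>t. f x (q(j := t))) differentiable (at (q j))) \<and>
     cont_diff X k (partial_x f) \<and>
     (\<forall>j. cont_diff X k (partial_q j f))"

definition q_function_of_order :: "real set \<Rightarrow> nat \<Rightarrow> qfun \<Rightarrow> bool" where
  "q_function_of_order X m f \<longleftrightarrow>
     (\<forall>x q q'. (x, q) \<in> qdom X \<and> (x, q') \<in> qdom X \<and> (\<forall>i\<le>m. q i = q' i) \<longrightarrow> f x q = f x q') \<and>
     (\<forall>k. cont_diff X k f)"

definition q_function :: "real set \<Rightarrow> qfun \<Rightarrow> bool" where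
  "q_function X f \<longleftrightarrow> (\<exists>m. q_function_of_order X m f)"

text \<open>For a q-function, only finitely many terms of the two series below are nonzero at points
  of the domain, so there \<open>suminf\<close> is a finite sum.\<close>

definition total_D :: "qfun \<Rightarrow> qfun" where
  "total_D f = (\<lambda>x q. partial_x f x q + (\<Sum>j. q (Suc j) * partial_q j f x q))"

definition L_op :: "qfun \<Rightarrow> qfun" where
  "L_op f = (\<lambda>x q. \<Sum>k. (- 1) ^ (k + 1) * (total_D ^^ k) (\<lambda>y r. r 0 * partial_q k f y r) x q)"

definition zero_homogeneous :: "real set \<Rightarrow> qfun \<Rightarrow> bool" where
  "zero_homogeneous X f \<longleftrightarrow>
     (\<forall>(x, q) \<in> qdom X. \<forall>l>0. f x (\<lambda>i. l * q i) = f x q)"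

end

theory Submission
  imports Defs
begin

text \<open>
  Write \<open>f[v]\<close> for the function \<open>x \<mapsto> f (x, v x, v' x, v'' x, \<dots>)\<close>, where \<open>v > 0\<close>, and
  \<open>\<delta>\<^sub>w f[v]\<close> for its derivative in the direction \<open>w\<close>.  Integrating by parts in
  \<open>v * \<delta>\<^sub>w f[v]\<close> moves all derivatives off \<open>w\<close> and gives the Lagrange identity
  \<open>v * \<delta>\<^sub>w f[v] + w * (Lf)[v] = d/dx A(v, w)\<close>, in which \<open>A\<close> involves only finitely many
  derivatives of \<open>v\<close> and \<open>w\<close> (lemma \<open>DERIV_concomitant\<close>).

  In the language of the calculus of variations, suppose \<open>Lf = 0\<close>.  The identity then says that \<open>f\<close>
  is the Euler-Lagrange expression of the Lagrangian \<open>q\<^sub>0 f\<close>: a variation of \<open>\<integral> v * f[v]\<close> by a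
  function \<open>\<psi>\<close> that is flat at the ends of the interval equals \<open>\<integral> \<psi> * f[v]\<close>.  The same holds for
  \<open>\<integral> v * f[l v]\<close> and \<open>\<integral> \<psi> * f[l v]\<close>, for every \<open>l > 0\<close>.  On the other hand, the choice \<open>w = v\<close> in
  the identity shows that the derivative of \<open>\<integral> v * f[l v]\<close> with respect to \<open>l\<close> is a boundary term,
  so \<open>q\<^sub>0 (f (x, l q) - f (x, q))\<close> is a null Lagrangian.  Its Euler-Lagrange expression
  \<open>f (x, l q) - f (x, q)\<close> therefore vanishes, which is the claim.

  Lemma \<open>integral_bump_scaling_invariant\<close> carries this out with integrals over a small interval: it
  yields \<open>\<integral> \<psi> * f[l u] = \<integral> \<psi> * f[u]\<close>.  Taking for \<open>u\<close> a polynomial with a given jet at a given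
  point, and for \<open>\<psi>\<close> a polynomial positive inside the interval, localises this equation to the point.
  The rest is calculus:
  q-functions are closed under the operations involved, and the chain rule
  (lemma \<open>q_function_chain_rule\<close>) identifies \<open>D\<close> with \<open>d/dx\<close> along jets.
\<close>

lemma qdom_iff [simp]: "(x, q) \<in> qdom X \<longleftrightarrow> x \<in> X \<and> 0 < q 0"
  by (auto simp: qdom_def)

section \<open>Closure properties of smooth q-functions\<close>

text \<open>Values off the domain are arbitrary, so smoothness proofs constantly replace a function by a
  formula that agrees with it on the domain only.  The domain is open in each single variable, hence
  one-variable derivatives and differentiability survive this replacement.\<close>
lemma partial_x_cong:
  assumes "open X" "(x, q) \<in> qdom X" "\<And>x q. (x, q) \<in> qdom X \<Longrightarrow> f x q = g x q"
  shows "partial_x f x q = partial_x g x q"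
    and "(\<lambda>t. f t q) differentiable (at x) \<Longrightarrow> (\<lambda>t. g t q) differentiable (at x)"
proof -
  have ev: "eventually (\<lambda>t. t \<in> X) (nhds x)"
    using assms(1,2) by (auto intro: eventually_nhds_in_open)
  have ev: "eventually (\<lambda>t. f t q = g t q) (nhds x)"
    using ev by eventually_elim (use assms(2,3) in auto)
  show "partial_x f x q = partial_x g x q"
    unfolding partial_x_def by (rule deriv_cong_ev[OF ev refl])
  show "(\<lambda>t. g t q) differentiable (at x)" if "(\<lambda>t. f t q) differentiable (at x)"
    using that ev DERIV_cong_ev[OF refl ev refl] by (auto simp: real_differentiable_def)
qed

lemma eventually_fun_upd_qdom:
  assumes "(x, q) \<in> qdom X"
  shows "eventually (\<lambda>t. (x, q(j := t)) \<in> qdom X) (nhds (q j))"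
proof (cases "j = 0")
  case True
  have "eventually (\<lambda>t. t \<in> {0<..}) (nhds (q 0))"
    using assms by (intro eventually_nhds_in_open) auto
  then show ?thesis using assms True by (auto elim: eventually_mono)
qed (use assms in auto)

lemma partial_q_cong:
  assumes "(x, q) \<in> qdom X" "\<And>x q. (x, q) \<in> qdom X \<Longrightarrow> f x q = g x q"
  shows "partial_q j f x q = partial_q j g x q"
    and "(\<lambda>t. f x (q(j := t))) differentiable (at (q j)) \<Longrightarrow>
      (\<lambda>t. g x (q(j := t))) differentiable (at (q j))"
proof -
  have ev: "eventually (\<lambda>t. f x (q(j := t)) = g x (q(j := t))) (nhds (q j))"
    using eventually_fun_upd_qdom[OF assms(1), of j] by eventually_elim (use assms in auto)
  show "partial_q j f x q = partial_q j g x q"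
    unfolding partial_q_def by (rule deriv_cong_ev[OF ev refl])
  show "(\<lambda>t. g x (q(j := t))) differentiable (at (q j))"
    if "(\<lambda>t. f x (q(j := t))) differentiable (at (q j))"
    using that ev DERIV_cong_ev[OF refl ev refl] by (auto simp: real_differentiable_def)
qed

lemma cont_diff_Suc_iff:
  "cont_diff X (Suc k) f \<longleftrightarrow> continuous_on (qdom X) (\<lambda>(x, q). f x q) \<and>
     (\<forall>x q. (x, q) \<in> qdom X \<longrightarrow> (\<lambda>t. f t q) differentiable (at x)) \<and>
     (\<forall>j x q. (x, q) \<in> qdom X \<longrightarrow> (\<lambda>t. f x (q(j := t))) differentiable (at (q j))) \<and>
     cont_diff X k (partial_x f) \<and> (\<forall>j. cont_diff X k (partial_q j f))"
  by (simp only: cont_diff.simps case_prod_unfold split_paired_all Ball_def split_paired_All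
      fst_conv snd_conv)

lemma cont_diff_partial_x: "cont_diff X (Suc k) f \<Longrightarrow> cont_diff X k (partial_x f)"
  and cont_diff_partial_q: "cont_diff X (Suc k) f \<Longrightarrow> cont_diff X k (partial_q j f)"
  by simp_all

lemma cont_diff_cong:
  assumes "open X" "\<And>x q. (x, q) \<in> qdom X \<Longrightarrow> f x q = g x q" "cont_diff X k f"
  shows "cont_diff X k g"
  using assms(2,3)
proof (induction k arbitrary: f g)
  case 0
  then show ?case
    by (auto intro: continuous_on_eq)
next
  case (Suc k)
  have "continuous_on (qdom X) (\<lambda>(x, q). g x q)"
    using Suc.prems by (auto intro: continuous_on_eq)
  moreover have "(\<lambda>t. g t q) differentiable (at x)"
    and "(\<lambda>t. g x (q(j := t))) differentiable (at (q j))" if "(x, q) \<in> qdom X" for x q j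
    using partial_x_cong(2)[OF assms(1) that, of f g] partial_q_cong(2)[OF that, of f g]
      Suc.prems that unfolding cont_diff_Suc_iff by (simp_all del: qdom_iff)
  moreover have "cont_diff X k (partial_x g)"
    by (rule Suc.IH[OF _ cont_diff_partial_x[OF Suc.prems(2)]])
       (rule partial_x_cong(1)[OF assms(1)]; use Suc.prems(1) in blast)
  moreover have "cont_diff X k (partial_q j g)" for j
    by (rule Suc.IH[OF _ cont_diff_partial_q[OF Suc.prems(2)]])
       (rule partial_q_cong(1); use Suc.prems(1) in blast)
  ultimately show ?case unfolding cont_diff_Suc_iff by blast
qed

lemma cont_diff_continuous: "cont_diff X k f \<Longrightarrow> continuous_on (qdom X) (\<lambda>(x, q). f x q)"
  by (cases k) auto

text \<open>It suffices to exhibit formulas for the partial derivatives that hold on the domain.\<close>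
lemma cont_diff_SucI:
  assumes "open X" "continuous_on (qdom X) (\<lambda>(x, q). f x q)"
    and "\<And>x q. (x, q) \<in> qdom X \<Longrightarrow> ((\<lambda>t. f t q) has_real_derivative fx x q) (at x)"
    and "\<And>x q j. (x, q) \<in> qdom X \<Longrightarrow>
      ((\<lambda>t. f x (q(j := t))) has_real_derivative fq j x q) (at (q j))"
    and "cont_diff X k fx" "\<And>j. cont_diff X k (fq j)"
  shows "cont_diff X (Suc k) f"
proof -
  have "fx x q = partial_x f x q" "fq j x q = partial_q j f x q" if "(x, q) \<in> qdom X" for x q j
    using assms(3)[OF that] assms(4)[OF that, of j]
    by (auto simp: partial_x_def partial_q_def DERIV_imp_deriv)
  then have "cont_diff X k (partial_x f)" "cont_diff X k (partial_q j f)" for j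
    using cont_diff_cong[OF assms(1) _ assms(5), of "partial_x f"]
      cont_diff_cong[OF assms(1) _ assms(6), of j "partial_q j f"] by auto
  then show ?thesis
    unfolding cont_diff_Suc_iff using assms(2-4) real_differentiable_def by blast
qed

lemma
  assumes "cont_diff X (Suc k) f" "(x, q) \<in> qdom X"
  shows has_partial_x: "((\<lambda>t. f t q) has_real_derivative partial_x f x q) (at x)"
    and has_partial_q: "((\<lambda>t. f x (q(j := t))) has_real_derivative partial_q j f x q) (at (q j))"
  using assms unfolding cont_diff_Suc_iff partial_x_def partial_q_def
    DERIV_deriv_iff_real_differentiable by blast+

lemma cont_diff_Suc_imp: "cont_diff X (Suc k) f \<Longrightarrow> cont_diff X k f"
proof (induction k arbitrary: f)
  case 0
  then show ?case by simp
next
  case (Suc k)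
  have "cont_diff X k (partial_x f)" "cont_diff X k (partial_q j f)" for j
    by (rule Suc.IH[OF cont_diff_partial_x[OF Suc.prems]] Suc.IH[OF cont_diff_partial_q[OF Suc.prems]])+
  then show ?case using Suc.prems unfolding cont_diff_Suc_iff[of X "Suc k"] cont_diff_Suc_iff[of X k f]
    by blast
qed

lemma cont_diff_const: "open X \<Longrightarrow> cont_diff X k (\<lambda>x q. c)"
proof (induction k arbitrary: c)
  case (Suc k)
  show ?case
    by (rule cont_diff_SucI[where fx = "\<lambda>x q. 0" and fq = "\<lambda>j x q. 0"]) (use Suc in auto)
qed auto

lemma continuous_on_coord: "continuous_on S (\<lambda>(x :: real, q :: nat \<Rightarrow> real). q i)"
  unfolding case_prod_unfold
  by (rule continuous_on_product_then_coordinatewise[OF continuous_on_snd[OF continuous_on_id]])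

lemma cont_diff_coord: "open X \<Longrightarrow> cont_diff X k (\<lambda>x q. q i)"
proof (cases k)
  case (Suc k)
  assume "open X"
  then show ?thesis
    unfolding Suc
    by (intro cont_diff_SucI[where fx = "\<lambda>x q. 0" and fq = "\<lambda>j x q. if i = j then 1 else 0"]
          cont_diff_const continuous_on_coord)
       (auto intro!: derivative_eq_intros)
qed (auto intro: continuous_on_coord)

lemma cont_diff_add:
  "open X \<Longrightarrow> cont_diff X k f \<Longrightarrow> cont_diff X k g \<Longrightarrow> cont_diff X k (\<lambda>x q. f x q + g x q)"
proof (induction k arbitrary: f g)
  case (Suc k)
  have "continuous_on (qdom X) (\<lambda>(x, q). f x q + g x q)"
    using cont_diff_continuous[OF Suc.prems(2)] cont_diff_continuous[OF Suc.prems(3)]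
    unfolding case_prod_unfold by (rule continuous_on_add)
  moreover have "((\<lambda>t. f t q + g t q) has_real_derivative
        partial_x f x q + partial_x g x q) (at x)"
      "((\<lambda>t. f x (q(j := t)) + g x (q(j := t))) has_real_derivative
        partial_q j f x q + partial_q j g x q) (at (q j))"
      if "(x, q) \<in> qdom X" for x q j
    using DERIV_add[OF has_partial_x[OF Suc.prems(2) that] has_partial_x[OF Suc.prems(3) that]]
      DERIV_add[OF has_partial_q[OF Suc.prems(2) that, of j] has_partial_q[OF Suc.prems(3) that, of j]]
    by (simp_all del: fun_upd_apply)
  moreover have "cont_diff X k (partial_x f)" "cont_diff X k (partial_q j f)"
    "cont_diff X k (partial_x g)" "cont_diff X k (partial_q j g)" for j
    using Suc.prems by (simp_all only: cont_diff_partial_x cont_diff_partial_q)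
  ultimately show ?case
    by (intro cont_diff_SucI[where fx = "\<lambda>x q. partial_x f x q + partial_x g x q"
          and fq = "\<lambda>j x q. partial_q j f x q + partial_q j g x q"] Suc.IH Suc.prems(1))
qed (auto intro!: continuous_on_add simp: case_prod_unfold)

lemma cont_diff_mult:
  "open X \<Longrightarrow> cont_diff X k f \<Longrightarrow> cont_diff X k g \<Longrightarrow> cont_diff X k (\<lambda>x q. f x q * g x q)"
proof (induction k arbitrary: f g)
  case (Suc k)
  have "cont_diff X k (partial_x f)" "cont_diff X k (partial_q j f)"
    "cont_diff X k (partial_x g)" "cont_diff X k (partial_q j g)" for j
    using Suc.prems by (simp_all only: cont_diff_partial_x cont_diff_partial_q)
  moreover have "cont_diff X k f" "cont_diff X k g"
    using Suc.prems by (simp_all only: cont_diff_Suc_imp)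
  moreover have "continuous_on (qdom X) (\<lambda>(x, q). f x q * g x q)"
    using cont_diff_continuous[OF Suc.prems(2)] cont_diff_continuous[OF Suc.prems(3)]
    unfolding case_prod_unfold by (rule continuous_on_mult)
  moreover have "((\<lambda>t. f t q * g t q) has_real_derivative
        partial_x f x q * g x q + partial_x g x q * f x q) (at x)"
      "((\<lambda>t. f x (q(j := t)) * g x (q(j := t))) has_real_derivative
        partial_q j f x q * g x q + partial_q j g x q * f x q) (at (q j))"
      if "(x, q) \<in> qdom X" for x q j
    using DERIV_mult[OF has_partial_x[OF Suc.prems(2) that] has_partial_x[OF Suc.prems(3) that]]
      DERIV_mult[OF has_partial_q[OF Suc.prems(2) that, of j] has_partial_q[OF Suc.prems(3) that, of j]]
    by (simp_all del: fun_upd_apply)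
  ultimately show ?case
    by (intro cont_diff_SucI[where fx = "\<lambda>x q. partial_x f x q * g x q + partial_x g x q * f x q"
          and fq = "\<lambda>j x q. partial_q j f x q * g x q + partial_q j g x q * f x q"]
        Suc.IH cont_diff_add Suc.prems(1))
qed (auto intro!: continuous_on_mult simp: case_prod_unfold)

lemma cont_diff_sum:
  assumes "open X" "\<And>i. i \<in> I \<Longrightarrow> cont_diff X k (f i)"
  shows "cont_diff X k (\<lambda>x q. \<Sum>i\<in>I. f i x q)"
  using assms(2)
  by (induction I rule: infinite_finite_induct)
     (auto intro!: cont_diff_const cont_diff_add assms(1))

lemma q_function_of_order_cont_diff: "q_function_of_order X m f \<Longrightarrow> cont_diff X k f"
  by (auto simp: q_function_of_order_def)

lemma q_function_of_order_eq:
  "q_function_of_order X m f \<Longrightarrow> (x, q) \<in> qdom X \<Longrightarrow> (x, q') \<in> qdom X \<Longrightarrow>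
    (\<And>i. i \<le> m \<Longrightarrow> q i = q' i) \<Longrightarrow> f x q = f x q'"
  unfolding q_function_of_order_def by blast

lemma q_function_of_order_cong:
  assumes "open X" "\<And>x q. (x, q) \<in> qdom X \<Longrightarrow> f x q = g x q" "q_function_of_order X m f"
  shows "q_function_of_order X m g"
  unfolding q_function_of_order_def
proof (intro conjI allI impI)
  show "cont_diff X k g" for k
    using cont_diff_cong[OF assms(1,2)] assms(3) by (auto simp: q_function_of_order_def)
next
  fix x q q' assume *: "(x, q) \<in> qdom X \<and> (x, q') \<in> qdom X \<and> (\<forall>i\<le>m. q i = q' i)"
  then have "f x q = f x q'" by (intro q_function_of_order_eq[OF assms(3)]) auto
  with * assms(2) show "g x q = g x q'" by metis
qed

lemma q_function_of_order_partial_x: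
  assumes "open X" "q_function_of_order X m f"
  shows "q_function_of_order X m (partial_x f)"
  unfolding q_function_of_order_def
proof (intro conjI allI impI)
  fix k show "cont_diff X k (partial_x f)"
    by (rule cont_diff_partial_x[OF q_function_of_order_cont_diff[OF assms(2)]])
next
  fix x q q' assume *: "(x, q) \<in> qdom X \<and> (x, q') \<in> qdom X \<and> (\<forall>i\<le>m. q i = q' i)"
  have "eventually (\<lambda>t. t \<in> X) (nhds x)"
    using assms(1) * by (auto intro: eventually_nhds_in_open)
  then have "eventually (\<lambda>t. f t q = f t q') (nhds x)"
    by eventually_elim (use * in \<open>auto intro: q_function_of_order_eq[OF assms(2)]\<close>)
  then show "partial_x f x q = partial_x f x q'"
    unfolding partial_x_def by (rule deriv_cong_ev) auto
qed

lemma partial_q_zero: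
  assumes "q_function_of_order X m f" "(x, q) \<in> qdom X" "j > m"
  shows "partial_q j f x q = 0"
proof -
  have "f x (q(j := t)) = f x q" for t
    using assms by (intro q_function_of_order_eq[OF assms(1)]) auto
  then show ?thesis by (simp add: partial_q_def)
qed

lemma q_function_of_order_partial_q:
  assumes "q_function_of_order X m f"
  shows "q_function_of_order X m (partial_q j f)"
  unfolding q_function_of_order_def
proof (intro conjI allI impI)
  fix k show "cont_diff X k (partial_q j f)"
    by (rule cont_diff_partial_q[OF q_function_of_order_cont_diff[OF assms]])
next
  fix x q q' assume *: "(x, q) \<in> qdom X \<and> (x, q') \<in> qdom X \<and> (\<forall>i\<le>m. q i = q' i)"
  show "partial_q j f x q = partial_q j f x q'"
  proof (cases "j \<le> m")
    case True
    have "eventually (\<lambda>t. (x, q(j := t)) \<in> qdom X) (nhds (q j))"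
      "eventually (\<lambda>t. (x, q'(j := t)) \<in> qdom X) (nhds (q j))"
      using eventually_fun_upd_qdom[of x q X j] eventually_fun_upd_qdom[of x q' X j] * True by auto
    then have "eventually (\<lambda>t. f x (q(j := t)) = f x (q'(j := t))) (nhds (q j))"
      by eventually_elim (use * in \<open>auto intro!: q_function_of_order_eq[OF assms]\<close>)
    then show ?thesis
      unfolding partial_q_def by (rule deriv_cong_ev) (use * True in auto)
  qed (use * in \<open>auto simp: partial_q_zero[OF assms]\<close>)
qed

lemma total_D_eq_sum:
  assumes "q_function_of_order X m f" "(x, q) \<in> qdom X"
  shows "total_D f x q = partial_x f x q + (\<Sum>j\<le>m. q (Suc j) * partial_q j f x q)"
  unfolding total_D_def
  by (subst suminf_finite[of "{..m}"]) (use partial_q_zero[OF assms] in auto)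

text \<open>Each application of \<open>D\<close> raises the order by one, because of the factor \<open>q (Suc m)\<close>.\<close>
lemma q_function_of_order_total_D:
  assumes "open X" "q_function_of_order X m f"
  shows "q_function_of_order X (Suc m) (total_D f)"
proof (rule q_function_of_order_cong[OF assms(1)])
  show "partial_x f x q + (\<Sum>j\<le>m. q (Suc j) * partial_q j f x q) = total_D f x q"
    if "(x, q) \<in> qdom X" for x q using total_D_eq_sum[OF assms(2) that] by simp
  note p = q_function_of_order_partial_x[OF assms] q_function_of_order_partial_q[OF assms(2)]
  show "q_function_of_order X (Suc m)
      (\<lambda>x q. partial_x f x q + (\<Sum>j\<le>m. q (Suc j) * partial_q j f x q))"
    unfolding q_function_of_order_def
  proof (intro conjI allI impI)
    fix k show "cont_diff X k (\<lambda>x q. partial_x f x q + (\<Sum>j\<le>m. q (Suc j) * partial_q j f x q))"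
      by (intro cont_diff_add cont_diff_sum cont_diff_mult cont_diff_coord assms(1)
           p[THEN q_function_of_order_cont_diff])
  next
    fix x q q' assume *: "(x, q) \<in> qdom X \<and> (x, q') \<in> qdom X \<and> (\<forall>i\<le>Suc m. q i = q' i)"
    have "partial_x f x q = partial_x f x q'" "partial_q j f x q = partial_q j f x q'" for j
      using * by (auto intro!: p[THEN q_function_of_order_eq])
    then show "partial_x f x q + (\<Sum>j\<le>m. q (Suc j) * partial_q j f x q) =
         partial_x f x q' + (\<Sum>j\<le>m. q' (Suc j) * partial_q j f x q')"
      using * by auto
  qed
qed

lemma q_function_of_order_total_D_funpow:
  assumes "open X" "q_function_of_order X m f"
  shows "q_function_of_order X (m + k) ((total_D ^^ k) f)"
  by (induction k) (auto intro: q_function_of_order_total_D assms)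

lemma q_function_of_order_weighted:
  assumes "open X" "q_function_of_order X m f"
  shows "q_function_of_order X m (\<lambda>x q. q 0 * f x q)"
  unfolding q_function_of_order_def
proof (intro conjI allI impI)
  show "cont_diff X k (\<lambda>x q. q 0 * f x q)" for k
    by (intro cont_diff_mult cont_diff_coord assms q_function_of_order_cont_diff[OF assms(2)])
  show "q 0 * f x q = q' 0 * f x q'"
    if "(x, q) \<in> qdom X \<and> (x, q') \<in> qdom X \<and> (\<forall>i\<le>m. q i = q' i)" for x q q'
    using q_function_of_order_eq[OF assms(2), of x q q'] that by simp
qed

text \<open>This truncates the series defining \<open>L_op\<close>: for \<open>k\<close> beyond the order, \<open>partial_q k f\<close> vanishes
  on the domain, although perhaps not off it.\<close>
lemma total_D_funpow_zero:
  assumes "open X" "\<And>x q. (x, q) \<in> qdom X \<Longrightarrow> f x q = 0" "(x, q) \<in> qdom X"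
  shows "(total_D ^^ k) f x q = 0"
  using assms(3)
proof (induction k arbitrary: x q)
  case (Suc k)
  have "partial_x ((total_D ^^ k) f) x q = partial_x (\<lambda>x q. 0) x q"
    by (rule partial_x_cong[OF assms(1) Suc.prems]) (rule Suc.IH)
  then have "partial_x ((total_D ^^ k) f) x q = 0" by (simp add: partial_x_def)
  moreover have "partial_q j ((total_D ^^ k) f) x q = 0" for j
  proof -
    have "partial_q j ((total_D ^^ k) f) x q = partial_q j (\<lambda>x q. 0) x q"
      by (rule partial_q_cong[OF Suc.prems]) (rule Suc.IH)
    then show ?thesis by (simp add: partial_q_def)
  qed
  ultimately show ?case by (simp add: total_D_def[of "(total_D ^^ k) f"])
qed (use assms in auto)

lemma L_op_eq_sum:
  assumes "open X" "q_function_of_order X m f" "(x, q) \<in> qdom X"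
  shows "L_op f x q =
    - (\<Sum>k\<le>m. (- 1) ^ k * (total_D ^^ k) (\<lambda>y r. r 0 * partial_q k f y r) x q)"
proof -
  have "(total_D ^^ k) (\<lambda>y r. r 0 * partial_q k f y r) x q = 0" if "k > m" for k
    using assms that by (intro total_D_funpow_zero[of X]) (auto simp: partial_q_zero[OF assms(2)])
  then show ?thesis
    unfolding L_op_def by (subst suminf_finite[of "{..m}"]) (auto simp: sum_negf)
qed

section \<open>The chain rule along curves\<close>
lemma tendsto_coordinatewise:
  fixes f :: "'a \<Rightarrow> 'b \<Rightarrow> 'c :: topological_space"
  assumes "\<And>i. ((\<lambda>t. f t i) \<longlongrightarrow> l i) F"
  shows "(f \<longlongrightarrow> l) F"
proof -
  have "limitin (product_topology (\<lambda>i. euclidean) UNIV) f l F"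
    unfolding limitin_componentwise using assms by (auto simp: limitin_canonical_iff)
  then show ?thesis by (simp add: euclidean_product_topology limitin_canonical_iff)
qed

text \<open>One step of the telescoping argument behind the chain rule: by the mean value theorem, the
  increment is \<open>g' t z * (y t - y t0)\<close> with \<open>z\<close> between the two values of \<open>y\<close>.  The
  function \<open>g t\<close> itself moves with \<open>t\<close>, so only the joint limit of \<open>g' t z\<close> can be used.\<close>
lemma tendsto_increment_moving_coordinate:
  fixes g g' :: "real \<Rightarrow> real \<Rightarrow> real" and y :: "real \<Rightarrow> real"
  assumes y: "(y has_real_derivative y') (at t0 within U)"
    and g: "\<And>t z. t \<in> U \<Longrightarrow> z \<in> closed_segment (y t0) (y t) \<Longrightarrow>
      (g t has_real_derivative g' t z) (at z)"
    and lim: "\<And>z. (\<And>t. t \<in> U \<Longrightarrow> z t \<in> closed_segment (y t0) (y t)) \<Longrightarrow>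
      ((\<lambda>t. g' t (z t)) \<longlongrightarrow> d) (at t0 within U)"
  shows "((\<lambda>t. (g t (y t) - g t (y t0)) / (t - t0)) \<longlongrightarrow> d * y') (at t0 within U)"
proof -
  have "\<exists>z \<in> closed_segment (y t0) (y t). g t (y t) - g t (y t0) = g' t z * (y t - y t0)"
    if t: "t \<in> U" for t
  proof (cases "y t0" "y t" rule: linorder_cases)
    case less
    obtain z where "y t0 < z" "z < y t" "g t (y t) - g t (y t0) = (y t - y t0) * g' t z"
      using MVT2[OF less, of "g t" "g' t"] g[OF t] less
      by (auto simp: closed_segment_eq_real_ivl)
    then show ?thesis using less
      by (intro bexI[of _ z]) (auto simp: closed_segment_eq_real_ivl)
  next
    case greater
    obtain z where "y t < z" "z < y t0" "g t (y t0) - g t (y t) = (y t0 - y t) * g' t z"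
      using MVT2[OF greater, of "g t" "g' t"] g[OF t] greater
      by (auto simp: closed_segment_eq_real_ivl)
    then show ?thesis using greater
      by (intro bexI[of _ z]) (auto simp: closed_segment_eq_real_ivl algebra_simps)
  qed auto
  then obtain z where z: "\<And>t. t \<in> U \<Longrightarrow> z t \<in> closed_segment (y t0) (y t)"
    and eq: "\<And>t. t \<in> U \<Longrightarrow> g t (y t) - g t (y t0) = g' t (z t) * (y t - y t0)"
    by metis
  have "((\<lambda>t. g' t (z t) * ((y t - y t0) / (t - t0))) \<longlongrightarrow> d * y') (at t0 within U)"
    using y unfolding has_field_derivative_iff by (intro tendsto_mult lim z)
  then show ?thesis
    by (rule Lim_transform_eventually) (auto simp: eventually_at_filter eq intro!: always_eventually)
qed

lemma continuous_on_q_function_along: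
  assumes "q_function_of_order X m f"
    and "continuous_on S \<xi>" "\<And>i. continuous_on S (\<lambda>p. \<gamma> p i)"
    and "\<And>p. p \<in> S \<Longrightarrow> (\<xi> p, \<gamma> p) \<in> qdom X"
  shows "continuous_on S (\<lambda>p. f (\<xi> p) (\<gamma> p))"
proof -
  have "continuous_on (qdom X) (\<lambda>(x, q). f x q)"
    using cont_diff_continuous[OF q_function_of_order_cont_diff[OF assms(1)]] .
  moreover have "continuous_on S (\<lambda>p. (\<xi> p, \<gamma> p))"
    using assms by (intro continuous_on_Pair continuous_on_coordinatewise_then_product)
  ultimately have "continuous_on S (\<lambda>p. (\<lambda>(x, q). f x q) (\<xi> p, \<gamma> p))"
    by (rule continuous_on_compose2) (use assms(4) in blast)
  then show ?thesis by simp
qed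

text \<open>The argument space of all sequences is not normable, so there is no total derivative to
  compose with; continuity of the partial derivatives is used directly.  The coordinates are released
  one at a time: \<open>\<eta> n t\<close> follows the curve in the coordinates below \<open>n\<close> and is frozen at time
  \<open>t0\<close> in the others.  A relative neighbourhood \<open>U\<close> is allowed because one of the parameters
  below is restricted to an interval that is closed at the point of interest.\<close>
lemma q_function_chain_rule:
  fixes \<gamma> :: "real \<Rightarrow> nat \<Rightarrow> real"
  assumes f: "q_function_of_order X m f"
    and dom: "\<And>t. t \<in> U \<Longrightarrow> (\<xi> t, \<gamma> t) \<in> qdom X" and t0: "t0 \<in> U"
    and \<xi>: "(\<xi> has_real_derivative \<xi>') (at t0 within U)"
    and \<gamma>: "\<And>i. ((\<lambda>t. \<gamma> t i) has_real_derivative \<gamma>' i) (at t0 within U)"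
  shows "((\<lambda>t. f (\<xi> t) (\<gamma> t)) has_real_derivative
    partial_x f (\<xi> t0) (\<gamma> t0) * \<xi>' + (\<Sum>j\<le>m. \<gamma>' j * partial_q j f (\<xi> t0) (\<gamma> t0)))
    (at t0 within U)"
proof -
  note cd = q_function_of_order_cont_diff[OF f]
  define \<eta> where "\<eta> n t = (\<lambda>i. if i < n then \<gamma> t i else \<gamma> t0 i)" for n :: nat and t
  have \<eta>_t0: "\<eta> n t0 = \<gamma> t0" for n by (auto simp: \<eta>_def)
  have "((\<lambda>t. f (\<xi> t) (\<eta> n t)) has_real_derivative
     partial_x f (\<xi> t0) (\<gamma> t0) * \<xi>' + (\<Sum>j<n. \<gamma>' j * partial_q j f (\<xi> t0) (\<gamma> t0)))
     (at t0 within U)" for n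
  proof (induction n)
    case 0
    show ?case
      using DERIV_chain2[OF has_partial_x[OF cd dom[OF t0]] \<xi>] by (simp add: \<eta>_def)
  next
    case (Suc n)
    define g where "g t z = f (\<xi> t) ((\<eta> n t)(n := z))" for t z
    have g_Suc: "g t (\<gamma> t n) = f (\<xi> t) (\<eta> (Suc n) t)" and g_n: "g t (\<gamma> t0 n) = f (\<xi> t) (\<eta> n t)" for t
      by (auto simp: g_def \<eta>_def fun_upd_def intro!: arg_cong[of _ _ "f (\<xi> t)"])
    have pos: "(\<xi> t, (\<eta> n t)(n := z)) \<in> qdom X"
      if "t \<in> U" "z \<in> closed_segment (\<gamma> t0 n) (\<gamma> t n)" for t z
      using that dom[OF t0] dom[OF that(1)]
      by (auto simp: \<eta>_def closed_segment_eq_real_ivl split: if_splits)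
    have "((\<lambda>t. (g t (\<gamma> t n) - g t (\<gamma> t0 n)) / (t - t0)) \<longlongrightarrow>
        partial_q n f (\<xi> t0) (\<gamma> t0) * \<gamma>' n) (at t0 within U)"
    proof (rule tendsto_increment_moving_coordinate[OF \<gamma>])
      show "(g t has_real_derivative partial_q n f (\<xi> t) ((\<eta> n t)(n := z))) (at z)"
        if "t \<in> U" "z \<in> closed_segment (\<gamma> t0 n) (\<gamma> t n)" for t z
        using has_partial_q[OF cd pos[OF that], of n] by (simp add: g_def[abs_def])
    next
      fix z assume z: "\<And>t. t \<in> U \<Longrightarrow> z t \<in> closed_segment (\<gamma> t0 n) (\<gamma> t n)"
      have lim_\<gamma>: "((\<lambda>t. \<gamma> t i) \<longlongrightarrow> \<gamma> t0 i) (at t0 within U)" for i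
        using DERIV_continuous[OF \<gamma>[of i]] by (simp add: continuous_within)
      have "(z \<longlongrightarrow> \<gamma> t0 n) (at t0 within U)"
      proof (rule Lim_transform_bound[where g = "\<lambda>t. \<gamma> t n - \<gamma> t0 n", THEN LIM_zero_cancel])
        show "\<forall>\<^sub>F t in at t0 within U. norm (z t - \<gamma> t0 n) \<le> norm (\<gamma> t n - \<gamma> t0 n)"
          using segment_bound1[OF z] by (auto simp: eventually_at_filter intro!: always_eventually)
        show "((\<lambda>t. \<gamma> t n - \<gamma> t0 n) \<longlongrightarrow> 0) (at t0 within U)"
          using lim_\<gamma> by (rule LIM_zero)
      qed
      then have "((\<lambda>t. ((\<eta> n t)(n := z t)) i) \<longlongrightarrow> \<gamma> t0 i) (at t0 within U)" for i
        using lim_\<gamma>[of i] by (cases "i = n"; cases "i < n") (auto simp: \<eta>_def)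
      then have "((\<lambda>t. (\<eta> n t)(n := z t)) \<longlongrightarrow> \<gamma> t0) (at t0 within U)"
        by (rule tendsto_coordinatewise)
      moreover have "(\<xi> \<longlongrightarrow> \<xi> t0) (at t0 within U)"
        using DERIV_continuous[OF \<xi>] by (simp add: continuous_within)
      ultimately have "((\<lambda>t. (\<xi> t, (\<eta> n t)(n := z t))) \<longlongrightarrow> (\<xi> t0, \<gamma> t0)) (at t0 within U)"
        by (intro tendsto_Pair)
      then have "((\<lambda>t. (\<lambda>(x, q). partial_q n f x q) (\<xi> t, (\<eta> n t)(n := z t))) \<longlongrightarrow>
          (\<lambda>(x, q). partial_q n f x q) (\<xi> t0, \<gamma> t0)) (at t0 within U)"
        using pos[OF _ z] dom[OF t0]
        by (intro continuous_on_tendsto_compose[OF cont_diff_continuous[OF cont_diff_partial_q[OF cd]]])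
           (auto simp: eventually_at_filter simp del: qdom_iff intro!: always_eventually)
      then show "((\<lambda>t. partial_q n f (\<xi> t) ((\<eta> n t)(n := z t))) \<longlongrightarrow>
          partial_q n f (\<xi> t0) (\<gamma> t0)) (at t0 within U)" by simp
    qed
    then have "((\<lambda>t. f (\<xi> t) (\<eta> (Suc n) t) - f (\<xi> t) (\<eta> n t)) has_real_derivative
        \<gamma>' n * partial_q n f (\<xi> t0) (\<gamma> t0)) (at t0 within U)"
      unfolding has_field_derivative_iff g_Suc g_n by (simp add: \<eta>_t0 mult.commute)
    from DERIV_add[OF Suc.IH this] show ?case by (simp add: algebra_simps)
  qed
  from this[of "Suc m"] show ?thesis
    unfolding lessThan_Suc_atMost has_field_derivative_def
  proof (rule has_derivative_transform[OF t0, rotated])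
    show "f (\<xi> t) (\<gamma> t) = f (\<xi> t) (\<eta> (Suc m) t)" if "t \<in> U" for t
      using dom[OF that] dom[OF t0] by (intro q_function_of_order_eq[OF f]) (auto simp: \<eta>_def)
  qed
qed

section \<open>Jets of polynomials and the operator D\<close>

text \<open>The proof evaluates q-functions on \<open>(v, v', v'', \<dots>)\<close>.  Polynomials \<open>v\<close> suffice: they realise
  every finite jet, and powers of linear factors replace bump functions, since only finitely many
  derivatives have to vanish at the ends of an interval.\<close>
definition jet :: "real poly \<Rightarrow> real \<Rightarrow> nat \<Rightarrow> real" where
  "jet p x i = poly ((pderiv ^^ i) p) x"

lemma jet_0 [simp]: "jet p x 0 = poly p x"
  by (simp add: jet_def)

lemma jet_add: "jet (p + q) x i = jet p x i + jet q x i"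
  by (simp add: jet_def higher_pderiv_add)

lemma jet_smult: "jet (smult c p) x i = c * jet p x i"
  by (simp add: jet_def higher_pderiv_smult)

lemma DERIV_jet: "((\<lambda>x. jet p x i) has_real_derivative jet p x (Suc i)) (at x)"
  unfolding jet_def by (auto intro: poly_DERIV)

lemma continuous_on_jet [continuous_intros]:
  "continuous_on S h \<Longrightarrow> continuous_on S (\<lambda>z. jet p (h z) i)"
  unfolding jet_def by (intro continuous_on_poly)

text \<open>This is what \<open>D\<close> stands for: along a jet, it is differentiation with respect to \<open>x\<close>.\<close>
lemma total_D_along_jet:
  assumes "open X" "q_function_of_order X m g" "x \<in> X" "0 < poly v x"
  shows "((\<lambda>y. g y (jet v y)) has_real_derivative total_D g x (jet v x)) (at x)"
proof -
  define U where "U = X \<inter> {y. 0 < poly v y}"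
  have "open U" unfolding U_def
    by (intro open_Int assms open_Collect_less continuous_intros)
  moreover have "x \<in> U" using assms by (simp add: U_def)
  moreover have "((\<lambda>y. g y (jet v y)) has_real_derivative
      partial_x g x (jet v x) * 1 + (\<Sum>j\<le>m. jet v x (Suc j) * partial_q j g x (jet v x)))
      (at x within U)"
    using \<open>x \<in> U\<close>
    by (intro q_function_chain_rule[OF assms(2)] DERIV_ident has_field_derivative_at_within[OF DERIV_jet])
       (auto simp: U_def)
  ultimately show ?thesis
    using total_D_eq_sum[OF assms(2), of x "jet v x"] assms(3,4)
    by (simp add: at_within_open[of x U])
qed

section \<open>The Lagrange identity\<close>

text \<open>With \<open>q\<close> and \<open>r\<close> the jets of \<open>v\<close> and \<open>w\<close>, this is the first variation of \<open>f\<close> at \<open>v\<close> in the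
  direction \<open>w\<close>; the jets are generalised to independent sequences.\<close>
definition gateaux :: "nat \<Rightarrow> qfun \<Rightarrow> real \<Rightarrow> (nat \<Rightarrow> real) \<Rightarrow> (nat \<Rightarrow> real) \<Rightarrow> real" where
  "gateaux m f x q r = (\<Sum>j\<le>m. r j * partial_q j f x q)"

text \<open>The boundary terms produced by moving all derivatives from \<open>w\<close> to the other factor when
  \<open>\<Sum>k. (D^k w) * (v * partial_q k f)\<close> is integrated by parts, with \<open>q\<close> and \<open>r\<close> the jets of \<open>v\<close> and \<open>w\<close>.\<close>
definition concomitant :: "nat \<Rightarrow> qfun \<Rightarrow> real \<Rightarrow> (nat \<Rightarrow> real) \<Rightarrow> (nat \<Rightarrow> real) \<Rightarrow> real" where
  "concomitant m f x q r = (\<Sum>k\<le>m. \<Sum>i<k. (- 1) ^ i *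
     (r (k - Suc i) * (total_D ^^ i) (\<lambda>y s. s 0 * partial_q k f y s) x q))"

text \<open>With \<open>W\<close> and \<open>H\<close> the successive derivatives of two functions, the left-hand side is the
  derivative of the boundary term of a \<open>k\<close>-fold integration by parts.\<close>
lemma sum_alternating_telescope:
  fixes W H :: "nat \<Rightarrow> real"
  shows "(\<Sum>i<k. (- 1) ^ i * (W (Suc (k - Suc i)) * H i + H (Suc i) * W (k - Suc i))) =
    W k * H 0 - (- 1) ^ k * (W 0 * H k)"
proof -
  have "(\<Sum>i<k. (- 1) ^ i * (W (Suc (k - Suc i)) * H i + H (Suc i) * W (k - Suc i))) =
    (\<Sum>i<k. (- 1) ^ i * (W (k - i) * H i) - (- 1) ^ Suc i * (W (k - Suc i) * H (Suc i)))"
    by (intro sum.cong) (auto simp: Suc_diff_Suc algebra_simps)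
  also have "\<dots> = W k * H 0 - (- 1) ^ k * (W 0 * H k)"
    by (subst sum_lessThan_telescope') simp
  finally show ?thesis .
qed

text \<open>The Lagrange identity \<open>v * T w - w * T' v = d/dx A\<close> for the linearisation \<open>T\<close> of \<open>f\<close> at \<open>v\<close>
  and its formal adjoint \<open>T'\<close>.  Because of the weight \<open>q 0\<close> in \<open>L_op\<close>, the value \<open>T' v\<close> is \<open>L_op f\<close>
  with the opposite sign.\<close>
lemma DERIV_concomitant:
  assumes X: "open X" and f: "q_function_of_order X m f" and x: "x \<in> X" "0 < poly v x"
  shows "((\<lambda>y. concomitant m f y (jet v y) (jet w y)) has_real_derivative
    poly v x * gateaux m f x (jet v x) (jet w x) + poly w x * L_op f x (jet v x)) (at x)"
proof -
  define H where "H k i y = (total_D ^^ i) (\<lambda>y s. s 0 * partial_q k f y s) y (jet v y)" for k i y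
  have H: "(H k i has_real_derivative H k (Suc i) x) (at x)" for k i
    using total_D_along_jet[OF X q_function_of_order_total_D_funpow[OF X
        q_function_of_order_weighted[OF X q_function_of_order_partial_q[OF f]]] x]
    by (simp add: H_def[abs_def])
  have "((\<lambda>y. \<Sum>k\<le>m. \<Sum>i<k. (- 1) ^ i * (jet w y (k - Suc i) * H k i y)) has_real_derivative
     (\<Sum>k\<le>m. \<Sum>i<k. (- 1) ^ i * (jet w x (Suc (k - Suc i)) * H k i x + H k (Suc i) x * jet w x (k - Suc i))))
     (at x)"
    by (intro DERIV_sum DERIV_cmult DERIV_mult DERIV_jet H)
  also have "(\<Sum>k\<le>m. \<Sum>i<k. (- 1) ^ i * (jet w x (Suc (k - Suc i)) * H k i x + H k (Suc i) x * jet w x (k - Suc i)))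
    = (\<Sum>k\<le>m. jet w x k * H k 0 x - (- 1) ^ k * (jet w x 0 * H k k x))"
    by (simp only: sum_alternating_telescope[where W = "jet w x" and H = "\<lambda>i. H _ i x"])
  also have "\<dots> = (\<Sum>k\<le>m. jet w x k * H k 0 x) + poly w x * (- (\<Sum>k\<le>m. (- 1) ^ k * H k k x))"
    by (simp add: sum_subtractf sum_distrib_left algebra_simps)
  also have "(\<Sum>k\<le>m. jet w x k * H k 0 x) = poly v x * gateaux m f x (jet v x) (jet w x)"
    by (simp add: H_def gateaux_def sum_distrib_left algebra_simps)
  also have "- (\<Sum>k\<le>m. (- 1) ^ k * H k k x) = L_op f x (jet v x)"
    using L_op_eq_sum[OF X f, of x "jet v x"] x by (simp add: H_def)
  finally show ?thesis unfolding concomitant_def H_def .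
qed

text \<open>The index \<open>i < k \<le> m\<close> bounds the order of \<open>D^i (q 0 * partial_q k f)\<close> by \<open>2 * m\<close>; this is how
  flat a perturbation must be at the ends of an interval to leave the boundary terms unchanged.\<close>
lemma concomitant_cong:
  assumes X: "open X" and f: "q_function_of_order X m f"
    and "(x, q) \<in> qdom X" "(x, q') \<in> qdom X"
    and "\<And>i. i \<le> 2 * m \<Longrightarrow> q i = q' i" "\<And>i. i < m \<Longrightarrow> r i = r' i"
  shows "concomitant m f x q r = concomitant m f x q' r'"
proof -
  have "(total_D ^^ i) (\<lambda>y s. s 0 * partial_q k f y s) x q =
        (total_D ^^ i) (\<lambda>y s. s 0 * partial_q k f y s) x q'" if "k \<le> m" "i < k" for i k
    using that assms by (intro q_function_of_order_eq[OF q_function_of_order_total_D_funpow[OF X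
        q_function_of_order_weighted[OF X q_function_of_order_partial_q[OF f]]]]) auto
  then show ?thesis
    unfolding concomitant_def using assms(6) by (intro sum.cong refl) auto
qed

text \<open>If \<open>L_op f = 0\<close> on the domain, the weighted first variation is a pure boundary term.\<close>
lemma has_integral_weighted_variation:
  assumes X: "open X" and f: "q_function_of_order X m f"
    and L: "\<And>x q. (x, q) \<in> qdom X \<Longrightarrow> L_op f x q = 0"
    and ab: "a \<le> b" "{a..b} \<subseteq> X" and v: "\<And>x. x \<in> {a..b} \<Longrightarrow> 0 < poly v x"
  shows "((\<lambda>x. poly v x * gateaux m f x (jet v x) (jet w x)) has_integral
    concomitant m f b (jet v b) (jet w b) - concomitant m f a (jet v a) (jet w a)) {a..b}"
proof (rule fundamental_theorem_of_calculus[OF ab(1)])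
  fix x assume x: "x \<in> {a..b}"
  then have "x \<in> X" using ab by blast
  from DERIV_concomitant[OF X f this v[OF x], of w]
  show "((\<lambda>y. concomitant m f y (jet v y) (jet w y)) has_vector_derivative
      poly v x * gateaux m f x (jet v x) (jet w x)) (at x within {a..b})"
    using L[of x "jet v x"] v[OF x] \<open>x \<in> X\<close>
    by (auto simp: has_real_derivative_iff_has_vector_derivative intro: has_vector_derivative_at_within)
qed

section \<open>Polynomials with prescribed jets\<close>
lemma power_dvd_pderiv:
  assumes "p ^ Suc n dvd (q :: 'a :: idom poly)"
  shows "p ^ n dvd pderiv q"
proof -
  obtain r where "q = p ^ Suc n * r" using assms by (elim dvdE)
  then have "pderiv q = p ^ Suc n * pderiv r + r * (smult (of_nat (Suc n)) (p ^ n) * pderiv p)"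
    by (simp only: pderiv_mult pderiv_power_Suc)
  then show ?thesis by (simp add: dvd_add dvd_smult dvd_mult dvd_mult2)
qed

lemma jet_eq_0_if_power_dvd:
  assumes "[:- c, 1:] ^ n dvd p" "i < n"
  shows "jet p c i = 0"
proof -
  have "[:- c, 1:] ^ (n - i) dvd (pderiv ^^ i) p"
    using assms(2)
  proof (induction i)
    case (Suc i)
    then have "n - i = Suc (n - Suc i)" by simp
    then have "[:- c, 1:] ^ Suc (n - Suc i) dvd (pderiv ^^ i) p" using Suc by simp
    from power_dvd_pderiv[OF this] show ?case by simp
  qed (use assms in auto)
  then have "[:- c, 1:] dvd (pderiv ^^ i) p"
    by (rule dvd_trans[OF dvd_power, rotated]) (use assms(2) in auto)
  then show ?thesis by (simp add: jet_def poly_eq_0_iff_dvd)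
qed

lemma exists_poly_with_jet: "\<exists>p. \<forall>i\<le>n. jet p c i = q i"
proof -
  define r where "r = (\<Sum>i\<le>n. monom (q i / fact i) i)"
  have coeff_r: "coeff r i = q i / fact i" if "i \<le> n" for i
    using that by (simp add: r_def coeff_sum)
  have pc: "(pderiv ^^ i) (pcompose r [:- c, 1:]) = pcompose ((pderiv ^^ i) r) [:- c, 1:]" for i
    by (induction i) (simp_all add: pderiv_pcompose pderiv_pCons)
  have "jet (pcompose r [:- c, 1:]) c i = q i" if "i \<le> n" for i
    using coeff_r[OF that]
    by (simp add: jet_def pc poly_pcompose poly_0_coeff_0 coeff_higher_pderiv flip: pochhammer_fact)
  then show ?thesis by blast
qed

section \<open>Scale invariance of weighted integrals\<close>
lemma gateaux_scale: "gateaux m f x q (\<lambda>i. c * r i) = c * gateaux m f x q r"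
  by (simp add: gateaux_def sum_distrib_left mult.assoc)

lemma jet_smult_fun: "jet (smult c p) x = (\<lambda>i. c * jet p x i)"
  by (rule ext) (rule jet_smult)

text \<open>Both parameters of the family used below, a scale and a shift, move the jet along a line
  while \<open>x\<close> stays fixed.\<close>
lemma q_function_along_line:
  assumes f: "q_function_of_order X m f" and x: "x \<in> X"
    and pos: "\<And>t. t \<in> U \<Longrightarrow> 0 < q 0 + t * r 0" and t0: "t0 \<in> U"
  shows "((\<lambda>t. f x (\<lambda>i. q i + t * r i)) has_real_derivative
    gateaux m f x (\<lambda>i. q i + t0 * r i) r) (at t0 within U)"
proof -
  have "((\<lambda>t. f x (\<lambda>i. q i + t * r i)) has_real_derivative
      partial_x f x (\<lambda>i. q i + t0 * r i) * 0 +
      (\<Sum>j\<le>m. r j * partial_q j f x (\<lambda>i. q i + t0 * r i))) (at t0 within U)"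
    by (rule q_function_chain_rule[OF f _ t0, where \<xi> = "\<lambda>_. x"])
       (use x pos in \<open>auto intro!: derivative_eq_intros\<close>)
  then show ?thesis by (simp add: gateaux_def)
qed

lemma continuous_on_jet_pencil:
  assumes "continuous_on S s" "continuous_on S x"
  shows "continuous_on S (\<lambda>p. jet (u + smult (s p) \<psi>) (x p) i)"
  unfolding jet_add jet_smult using assms by (intro continuous_intros)

lemma continuous_on_q_function_jet_pencil:
  assumes "q_function_of_order X m g"
    and "continuous_on S l" "continuous_on S s" "continuous_on S x"
    and "\<And>p. p \<in> S \<Longrightarrow> 0 < l p" "\<And>p. p \<in> S \<Longrightarrow> x p \<in> X"
    and "\<And>p. p \<in> S \<Longrightarrow> 0 < poly (u + smult (s p) \<psi>) (x p)"
  shows "continuous_on S (\<lambda>p. g (x p) (jet (smult (l p) (u + smult (s p) \<psi>)) (x p)))"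
  using assms(5-7) unfolding jet_smult_fun
  by (intro continuous_on_q_function_along[OF assms(1)] continuous_on_mult
        continuous_on_jet_pencil assms(2-4)) auto

text \<open>The core of the proof.  With \<open>w s = u + s * \<psi>\<close>, the functional
  \<open>M l s = \<integral> w s * f (x, l * jet (w s))\<close> is differentiated in both parameters.

  The derivative in \<open>l\<close> is \<open>1 / l\<close> times a weighted first variation at \<open>l * w s\<close>, hence a boundary
  term; as \<open>\<psi>\<close> is flat at both ends, it does not depend on \<open>s\<close>.  Therefore \<open>M l s - M 1 s\<close> does not
  depend on \<open>s\<close>.

  The derivative in \<open>s\<close> has two parts.  One comes from the factor \<open>w s\<close> and is
  \<open>\<integral> \<psi> * f (x, l * jet (w s))\<close>; the other is a weighted first variation in the direction \<open>\<psi>\<close>,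
  whose boundary terms vanish.  At \<open>s = 0\<close>, equality of the derivatives for the scales \<open>l\<close> and \<open>1\<close>
  is the assertion.\<close>
lemma integral_bump_scaling_invariant:
  assumes X: "open X" and f: "q_function_of_order X m f"
    and L: "\<And>x q. (x, q) \<in> qdom X \<Longrightarrow> L_op f x q = 0"
    and ab: "a \<le> b" "{a..b} \<subseteq> X" and u: "\<And>x. x \<in> {a..b} \<Longrightarrow> 0 < poly u x"
    and \<psi>: "\<And>x. x \<in> {a..b} \<Longrightarrow> 0 \<le> poly \<psi> x"
    and vanish: "\<And>i. i \<le> 2 * m \<Longrightarrow> jet \<psi> a i = 0" "\<And>i. i \<le> 2 * m \<Longrightarrow> jet \<psi> b i = 0"
    and l: "0 < l"
  shows "integral {a..b} (\<lambda>x. poly \<psi> x * f x (\<lambda>i. l * jet u x i)) =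
    integral {a..b} (\<lambda>x. poly \<psi> x * f x (jet u x))"
proof -
  define w where "w s = u + smult s \<psi>" for s
  have jet_w: "jet (w s) x i = jet u x i + s * jet \<psi> x i" for s x i
    by (simp add: w_def jet_add jet_smult)
  have w_pos: "0 < poly (w s) x" if "0 \<le> s" "x \<in> {a..b}" for s x
    using u[OF that(2)] \<psi>[OF that(2)] that(1) by (simp add: w_def add_pos_nonneg)
  define M where "M l s = integral {a..b} (\<lambda>x. poly (w s) x * f x (jet (smult l (w s)) x))" for l s
  define c where "c l = (concomitant m f b (jet (smult l u) b) (jet u b) -
      concomitant m f a (jet (smult l u) a) (jet u a)) / l" for l
  have dom: "(x, jet (smult l (w s)) x) \<in> qdom X" if "0 < l" "0 \<le> s" "x \<in> {a..b}" for l s x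
    using that w_pos[of s x] ab by auto
  note cont = continuous_on_q_function_jet_pencil[where X = X and u = u and \<psi> = \<psi>, folded w_def]
  note cont_w = continuous_on_jet_pencil[where u = u and \<psi> = \<psi>, folded w_def]
  note dom' = w_pos ab(2)[THEN subsetD]

  have deriv_scale: "((\<lambda>l. M l s) has_real_derivative c l) (at l within {0<..})"
    if s: "0 \<le> s" and l: "0 < l" for s l
  proof -
    let ?G = "\<lambda>l x. poly (w s) x * gateaux m f x (jet (smult l (w s)) x) (jet (w s) x)"
    have "((\<lambda>l. M l s) has_real_derivative integral (cbox a b) (?G l)) (at l within {0<..})"
      unfolding M_def cbox_interval[symmetric]
    proof (rule leibniz_rule_field_derivative)
      fix l x :: real assume lx: "l \<in> {0<..}" "x \<in> cbox a b"
      have "((\<lambda>l. f x (\<lambda>i. 0 + l * jet (w s) x i)) has_real_derivative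
          gateaux m f x (\<lambda>i. 0 + l * jet (w s) x i) (jet (w s) x)) (at l within {0<..})"
        using lx w_pos[OF s, of x] ab(2) by (intro q_function_along_line[OF f]) auto
      then show "((\<lambda>l. poly (w s) x * f x (jet (smult l (w s)) x)) has_real_derivative ?G l x)
          (at l within {0<..})"
        unfolding jet_smult_fun by (intro DERIV_cmult) simp
    next
      fix l :: real assume "l \<in> {0<..}"
      then show "(\<lambda>x. poly (w s) x * f x (jet (smult l (w s)) x)) integrable_on cbox a b"
        using s by (intro integrable_continuous continuous_on_mult continuous_intros cont[OF f]) (auto intro: dom')
    next
      show "continuous_on ({0<..} \<times> cbox a b) (\<lambda>(l, x). ?G l x)"
        unfolding gateaux_def case_prod_unfold using s
        by (intro continuous_intros cont[OF q_function_of_order_partial_q[OF f]] cont_w) (auto intro: dom')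
    qed (use l in auto)
    moreover have "integral (cbox a b) (?G l) = c l"
    proof -
      have "((\<lambda>x. poly (smult l (w s)) x * gateaux m f x (jet (smult l (w s)) x) (jet (w s) x))
        has_integral concomitant m f b (jet (smult l (w s)) b) (jet (w s) b) -
          concomitant m f a (jet (smult l (w s)) a) (jet (w s) a)) {a..b}"
        using w_pos[OF s] l by (intro has_integral_weighted_variation[OF X f L ab]) auto
      moreover have "concomitant m f y (jet (smult l (w s)) y) (jet (w s) y) =
          concomitant m f y (jet (smult l u) y) (jet u y)" if "y = a \<or> y = b" for y
        using that vanish dom[OF l s, of y] dom[OF l, of 0 y] ab(1)
        by (intro concomitant_cong[OF X f]) (auto simp: jet_smult jet_w simp del: qdom_iff, auto simp: w_def)
      ultimately have "((\<lambda>x. l * ?G l x) has_integral l * c l) {a..b}"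
        using l by (simp add: c_def mult.assoc)
      from has_integral_mult_right[OF this, of "1 / l"] show ?thesis
        using l by (simp add: integral_unique)
    qed
    ultimately show ?thesis by simp
  qed

  (* Shifting by a negative s could destroy positivity of w s, hence the one-sided derivative at 0. *)
  have deriv_shift: "(M l has_real_derivative integral {a..b} (\<lambda>x. poly \<psi> x * f x (\<lambda>i. l * jet u x i)))
      (at 0 within {0..1})" if l: "0 < l" for l
  proof -
    let ?G = "\<lambda>s x. poly \<psi> x * f x (jet (smult l (w s)) x) +
      poly (smult l (w s)) x * gateaux m f x (jet (smult l (w s)) x) (jet \<psi> x)"
    have "(M l has_real_derivative integral (cbox a b) (?G 0)) (at 0 within {0..1})"
      unfolding M_def cbox_interval[symmetric]
    proof (rule leibniz_rule_field_derivative)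
      fix s x :: real assume sx: "s \<in> cbox 0 1" "x \<in> cbox a b"
      have "((\<lambda>s. f x (\<lambda>i. l * jet u x i + s * (l * jet \<psi> x i))) has_real_derivative
          gateaux m f x (\<lambda>i. l * jet u x i + s * (l * jet \<psi> x i)) (\<lambda>i. l * jet \<psi> x i)) (at s within cbox 0 1)"
        using sx u \<psi> ab(2) l by (intro q_function_along_line[OF f]) (auto intro!: add_pos_nonneg)
      then have "((\<lambda>s. f x (jet (smult l (w s)) x)) has_real_derivative
          l * gateaux m f x (jet (smult l (w s)) x) (jet \<psi> x)) (at s within cbox 0 1)"
        unfolding jet_smult_fun jet_w gateaux_scale by (simp add: algebra_simps)
      moreover have "((\<lambda>s. poly (w s) x) has_real_derivative poly \<psi> x) (at s within cbox 0 1)"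
        unfolding w_def by (auto intro!: derivative_eq_intros)
      ultimately show "((\<lambda>s. poly (w s) x * f x (jet (smult l (w s)) x)) has_real_derivative ?G s x)
          (at s within cbox 0 1)"
        using DERIV_mult by (fastforce simp: algebra_simps)
    next
      fix s :: real assume "s \<in> cbox 0 1"
      then show "(\<lambda>x. poly (w s) x * f x (jet (smult l (w s)) x)) integrable_on cbox a b"
        using l by (intro integrable_continuous continuous_on_mult continuous_intros cont[OF f]) (auto intro: dom')
    next
      have [continuous_intros]: "continuous_on S (\<lambda>p. poly (w (fst p)) (snd p))" for S
        using cont_w[of S fst snd 0] by (simp add: continuous_on_fst continuous_on_snd continuous_on_id)
      show "continuous_on (cbox 0 1 \<times> cbox a b) (\<lambda>(s, x). ?G s x)"
        unfolding gateaux_def case_prod_unfold poly_smult using l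
        by (intro continuous_intros cont[OF q_function_of_order_partial_q[OF f]] cont[OF f] cont_w) (auto intro: dom')
    qed auto
    moreover have "integral (cbox a b) (?G 0) = integral {a..b} (\<lambda>x. poly \<psi> x * f x (\<lambda>i. l * jet u x i))"
    proof -
      have "((\<lambda>x. poly (smult l (w 0)) x * gateaux m f x (jet (smult l (w 0)) x) (jet \<psi> x))
        has_integral concomitant m f b (jet (smult l (w 0)) b) (jet \<psi> b) -
          concomitant m f a (jet (smult l (w 0)) a) (jet \<psi> a)) {a..b}"
        using w_pos[of 0] l by (intro has_integral_weighted_variation[OF X f L ab]) auto
      moreover have "concomitant m f y q (jet \<psi> y) = 0" if "y = a \<or> y = b" for y q
        unfolding concomitant_def using that vanish by (intro sum.neutral ballI) auto
      ultimately have "((\<lambda>x. poly (smult l (w 0)) x * gateaux m f x (jet (smult l (w 0)) x) (jet \<psi> x))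
        has_integral 0) {a..b}" by simp
      moreover have "((\<lambda>x. poly \<psi> x * f x (jet (smult l (w 0)) x)) has_integral
          integral {a..b} (\<lambda>x. poly \<psi> x * f x (jet (smult l (w 0)) x))) {a..b}"
        using l by (intro integrable_integral integrable_continuous_real continuous_intros cont[OF f]) (auto intro: dom')
      ultimately have "(?G 0 has_integral
          integral {a..b} (\<lambda>x. poly \<psi> x * f x (jet (smult l (w 0)) x)) + 0) {a..b}"
        by (intro has_integral_add)
      then show ?thesis by (simp add: integral_unique jet_smult_fun w_def)
    qed
    ultimately show ?thesis by simp
  qed

  have const: "M l s - M 1 s = M l 0 - M 1 0" if s: "s \<in> {0..1}" for s
  proof -
    have "\<exists>d. \<forall>l\<in>{0<..}. M l s - M l 0 = d"
      by (rule has_field_derivative_zero_constant)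
         (use DERIV_diff[OF deriv_scale[of s] deriv_scale[of 0]] s in auto)
    then obtain d where "\<And>l. 0 < l \<Longrightarrow> M l s - M l 0 = d" by auto
    from this[OF l] this[of 1] show ?thesis by simp
  qed
  have "((\<lambda>s. M l s - M 1 s) has_real_derivative
      integral {a..b} (\<lambda>x. poly \<psi> x * f x (\<lambda>i. l * jet u x i)) -
      integral {a..b} (\<lambda>x. poly \<psi> x * f x (\<lambda>i. 1 * jet u x i))) (at 0 within {0..1})"
    by (intro DERIV_diff deriv_shift l) simp
  moreover have "((\<lambda>s. M l s - M 1 s) has_real_derivative 0) (at 0 within {0..1})"
    by (rule has_field_derivative_transform_within[OF DERIV_const[of "M l 0 - M 1 0"] zero_less_one])
       (simp, rule const[symmetric])
  moreover have "\<not> trivial_limit (at (0 :: real) within {0..1})"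
    by (simp add: trivial_limit_within)
  ultimately have "integral {a..b} (\<lambda>x. poly \<psi> x * f x (\<lambda>i. l * jet u x i)) -
      integral {a..b} (\<lambda>x. poly \<psi> x * f x (\<lambda>i. 1 * jet u x i)) = 0"
    unfolding has_field_derivative_iff using tendsto_unique by blast
  then show ?thesis by simp
qed

section \<open>Zero-homogeneity\<close>
theorem theorem6p1:
  fixes X :: "real set" and f :: qfun
  assumes "open X" and "is_interval X" and "X \<noteq> {}"
    and "q_function X f"
    and "\<forall>(x, q) \<in> qdom X. L_op f x q = 0"
  shows "zero_homogeneous X f"
proof -
  obtain m where f: "q_function_of_order X m f"
    using assms(4) by (auto simp: q_function_def)
  have L: "L_op f x q = 0" if "(x, q) \<in> qdom X" for x q
    using assms(5) that by blast
  have "f x0 (\<lambda>i. l * q i) = f x0 q" if x0: "(x0, q) \<in> qdom X" and l: "0 < l" for x0 q l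
  proof -
    obtain u where u: "\<And>i. i \<le> m \<Longrightarrow> jet u x0 i = q i"
      using exists_poly_with_jet[of m x0 q] by blast
    have u_pos: "0 < poly u x0" using u[of 0] x0 by simp
    define g where "g x = f x (\<lambda>i. l * jet u x i) - f x (jet u x)" for x
    have g_x0: "g x0 = f x0 (\<lambda>i. l * q i) - f x0 q"
      using x0 u u_pos l unfolding g_def
      by (intro arg_cong2[of _ _ _ _ "(-)"] q_function_of_order_eq[OF f]) auto
    define S where "S = X \<inter> {x. 0 < poly u x}"
    have "open S" unfolding S_def by (intro open_Int assms(1) open_Collect_less continuous_intros)
    have g_cont: "continuous_on S g"
      unfolding g_def using l
      by (intro continuous_intros continuous_on_q_function_along[OF f]) (auto simp: S_def)
    have "g x0 = 0"
    proof (rule ccontr)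
      assume "g x0 \<noteq> 0"
      (* On T the function g has the sign of g x0; multiplying by g x0 avoids a case distinction. *)
      define T where "T = {x \<in> S. 0 < g x * g x0}"
      have "open T" unfolding T_def
        using continuous_open_preimage[OF continuous_on_mult_right[OF g_cont, of "g x0"] \<open>open S\<close>, of "{0<..}"]
        by (simp add: vimage_def Int_def)
      moreover have "x0 \<in> T"
        using \<open>g x0 \<noteq> 0\<close> x0 u_pos by (auto simp: T_def S_def zero_less_mult_iff)
      ultimately obtain e where e: "0 < e" "cball x0 e \<subseteq> T" using open_contains_cball by blast
      define a b where "a = x0 - e" and "b = x0 + e"
      have ab: "a < x0" "x0 < b" "{a..b} \<subseteq> T"
        using e by (auto simp: a_def b_def cball_eq_atLeastAtMost)
      (* The exponent makes all derivatives of order at most 2 * m vanish at a and b. *)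
      define \<psi> where "\<psi> = ([:- a, 1:] * [:b, - 1:]) ^ Suc (2 * m)"
      have poly_\<psi>: "poly \<psi> x = ((x - a) * (b - x)) ^ Suc (2 * m)" for x
        by (simp add: \<psi>_def poly_power algebra_simps)
      have \<psi>_nonneg: "0 \<le> poly \<psi> x" if "x \<in> {a..b}" for x
        unfolding poly_\<psi> using that by (intro zero_le_power mult_nonneg_nonneg) auto
      have "[:b, - 1:] = [:- b, 1:] * [:- 1:]" by simp
      then have "[:- a, 1:] ^ Suc (2 * m) dvd \<psi>" "[:- b, 1:] ^ Suc (2 * m) dvd \<psi>"
        unfolding \<psi>_def power_mult_distrib by (metis dvd_triv_left dvd_mult power_mult_distrib)+
      then have vanish: "jet \<psi> a i = 0" "jet \<psi> b i = 0" if "i \<le> 2 * m" for i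
        using that by (auto intro: jet_eq_0_if_power_dvd simp del: power_Suc)
      have abS: "{a..b} \<subseteq> S" using ab(3) by (auto simp: T_def)
      have eq: "integral {a..b} (\<lambda>x. poly \<psi> x * f x (\<lambda>i. l * jet u x i)) =
          integral {a..b} (\<lambda>x. poly \<psi> x * f x (jet u x))"
        using ab abS by (intro integral_bump_scaling_invariant[OF assms(1) f L _ _ _ \<psi>_nonneg vanish l])
          (auto simp: S_def)
      have int: "(\<lambda>x. poly \<psi> x * f x (\<lambda>i. l * jet u x i)) integrable_on {a..b}"
          "(\<lambda>x. poly \<psi> x * f x (jet u x)) integrable_on {a..b}"
        using abS l
        by (intro integrable_continuous_real continuous_intros continuous_on_q_function_along[OF f];
            auto simp: S_def)+
      have "integral {a..b} (\<lambda>x. poly \<psi> x * g x) = 0"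
        using integral_diff[OF int] eq by (simp add: g_def right_diff_distrib)
      then have "integral {a..b} (\<lambda>x. poly \<psi> x * g x * g x0) = 0" by simp
      moreover have "continuous_on {a..b} (\<lambda>x. poly \<psi> x * g x * g x0)"
        by (intro continuous_intros continuous_on_subset[OF g_cont abS])
      moreover have "0 \<le> poly \<psi> x * g x * g x0" if "x \<in> {a..b}" for x
      proof -
        have "0 < g x * g x0" using that ab(3) by (auto simp: T_def)
        then show ?thesis using \<psi>_nonneg[OF that] by (simp add: mult.assoc)
      qed
      ultimately have "poly \<psi> x0 * g x0 * g x0 = 0"
        using integral_eq_0_iff[of a b "\<lambda>x. poly \<psi> x * g x * g x0"] ab by auto
      then show False using \<open>g x0 \<noteq> 0\<close> ab by (simp add: poly_\<psi>)
    qed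
    then show ?thesis using g_x0 by simp
  qed
  then show ?thesis unfolding zero_homogeneous_def by blast
qed

end
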